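(* Let $\{n_k\}_{k\ge 1}$ be a sequence of integers with $n_k\ge 2$ and $\{c_k\}_{k\ge 1}$ a sequence of positive reals with $c_kn_k<1$ for all $k\ge 1$. Let $E_1,E_2\in(\mathcal{M},c_k,n_k)$ be two Moran sets. Let $f$ be a continuous real-valued function defined on an open set $U\subset\mathbb{R}^2$. Suppose there exists some $(x_0,y_0)\in(E_1\times E_2)\cap U$ such that $$\sup_{k\ge 1}\{1-c_kn_k\}<\left|\frac{\partial_y f|_{(x_0,y_0)}}{\partial_x f|_{(x_0,y_0)}}\right|<\inf_{k\ge 1}\left\{\frac{c_k}{1-n_kc_k}\right\}.$$ Then the set $f_U(E_1,E_2)=\{f(x,y):(x,y)\in(E_1\times E_2)\cap U\}$ has nonempty interior in $\mathbb{R}$.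
   Context: Moran sets. Let $\{n_k\}_{k\ge1}$ be integers with $n_k\ge 2$ and $\{c_k\}_{k\ge1}$ positive reals with $c_kn_k<1$ for all $k$. For $k\ge1$ let $D_k=\{(\sigma_1,\dots,\sigma_k):\sigma_j\in\mathbb{N}^+,\ 1\le\sigma_j\le n_j,\ 1\le j\le k\}$, let $D_0$ consist of the empty word only, and let $D=\bigcup_{k\ge0}D_k$. For words $\sigma,\tau$, $\sigma*\tau$ denotes concatenation. Let $T=[0,1]$. A family $\mathcal{F}=\{T_\sigma\subset T:\sigma\in D\}$, with $T_\emptyset=T$ for the empty word, has the Moran structure (for $(c_k),(n_k)$) if: (1) for every $\sigma\in D$, $T_\sigma$ is similar to $T$, i.e. there is a similitude $S_\sigma:\mathbb{R}\to\mathbb{R}$ with $S_\sigma(T)=T_\sigma$; (2) for every $k\ge0$ and $\sigma\in D_k$, the sets $T_{\sigma*1},\dots,T_{\sigma*n_{k+1}}$ are subsets of $T_\sigma$ with pairwise disjoint interiors; (3) for every $k\ge1$, $\sigma\in D_{k-1}$ and $1\le i\le n_k$, $|T_{\sigma*i}|/|T_\sigma|=c_k$, where $|A|$ denotes the diameter of $A$; and the convex hull of $\bigcup_{i=1}^{n_k}T_{\sigma*i}$ coincides with $T_\sigma$. The set $E=\bigcap_{k\ge1}\bigcup_{\sigma\in D_k}T_\sigma$ is then called a Moran set, and $(\mathcal{M},c_k,n_k)$ denotes the collection of all Moran sets arising in this way from families $\mathcal{F}$ having the Moran structure for the given sequences $(c_k),(n_k)$. The convex hull of every $E\in(\mathcal{M},c_k,n_k)$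 is $[0,1]$. In the claim, $\partial_x f|_{(x_0,y_0)}$ and $\partial_y f|_{(x_0,y_0)}$ denote the partial derivatives of $f$ at $(x_0,y_0)$.
   Formalization: The formal theorem additionally assumes that both partial derivatives of f exist near (x_0,y_0) and are continuous at (x_0,y_0); with f merely continuous and having partial derivatives at the point, the claim is false. *)

theory Defs
  imports "HOL-Analysis.Analysis"
begin

definition similitude :: "(real \<Rightarrow> real) \<Rightarrow> bool" where
  "similitude S \<longleftrightarrow> (\<exists>r>0. \<forall>x y. \<bar>S x - S y\<bar> = r * \<bar>x - y\<bar>)"

(* The sequences (n_k) and (c_k) are indexed from 1; n 0 and c 0 are never used.
   List positions are counted from 0, so the letter at position j is sigma_(j+1). *)

definition words :: "(nat \<Rightarrow> nat) \<Rightarrow> nat \<Rightarrow> nat list set" where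
  "words n k = {\<sigma>. length \<sigma> = k \<and> (\<forall>j<k. 1 \<le> \<sigma> ! j \<and> \<sigma> ! j \<le> n (Suc j))}"

(* Only the values of T on the words of some (words n k) matter. *)

definition moran_structure ::
  "(nat \<Rightarrow> real) \<Rightarrow> (nat \<Rightarrow> nat) \<Rightarrow> (nat list \<Rightarrow> real set) \<Rightarrow> bool" where
  "moran_structure c n T \<longleftrightarrow>
     T [] = {0..1} \<and>
     (\<forall>k. \<forall>\<sigma>\<in>words n k. T \<sigma> \<subseteq> {0..1}) \<and>
     (\<forall>k. \<forall>\<sigma>\<in>words n k. \<exists>S. similitude S \<and> S ` {0..1} = T \<sigma>) \<and>
     (\<forall>k. \<forall>\<sigma>\<in>words n k.
        (\<forall>i\<in>{1..n (Suc k)}. T (\<sigma> @ [i]) \<subseteq> T \<sigma>) \<and>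
        disjoint_family_on (\<lambda>i. interior (T (\<sigma> @ [i]))) {1..n (Suc k)}) \<and>
     (\<forall>k\<ge>1. \<forall>\<sigma>\<in>words n (k - 1).
        (\<forall>i\<in>{1..n k}. diameter (T (\<sigma> @ [i])) / diameter (T \<sigma>) = c k) \<and>
        convex hull (\<Union>i\<in>{1..n k}. T (\<sigma> @ [i])) = T \<sigma>)"

definition moran_sets :: "(nat \<Rightarrow> real) \<Rightarrow> (nat \<Rightarrow> nat) \<Rightarrow> real set set" where
  "moran_sets c n =
     {E. \<exists>T. moran_structure c n T \<and> E = (\<Inter>k\<in>{1..}. \<Union>\<sigma>\<in>words n k. T \<sigma>)}"

definition partial_x :: "(real \<times> real \<Rightarrow> real) \<Rightarrow> real \<times> real \<Rightarrow> real" where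
  "partial_x f p = deriv (\<lambda>x. f (x, snd p)) (fst p)"

definition partial_y :: "(real \<times> real \<Rightarrow> real) \<Rightarrow> real \<times> real \<Rightarrow> real" where
  "partial_y f p = deriv (\<lambda>y. f (fst p, y)) (snd p)"

(* Since deriv is total, existence of the partial derivatives has to be required explicitly.
   They are required to exist near p and to be continuous at p only; this is implied by
   f being C^1 on a neighbourhood of p. *)

definition has_continuous_partials_at :: "(real \<times> real \<Rightarrow> real) \<Rightarrow> real \<times> real \<Rightarrow> bool" where
  "has_continuous_partials_at f p \<longleftrightarrow>
     (\<forall>\<^sub>F q in nhds p. (\<lambda>x. f (x, snd q)) differentiable (at (fst q)) \<and>
                       (\<lambda>y. f (fst q, y)) differentiable (at (snd q))) \<and>
     isCont (partial_x f) p \<and> isCont (partial_y f) p"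

end

(* All basic intervals of order k have the same length L = c_1 ... c_k, and a gap inside one of them
   has length at most L (1 - c_(k+1) n_(k+1)).  Near the base point f is bi-Lipschitz in each
   variable, with constants close to |f_x| and |f_y|.  Take a point of a basic square I x J.  If x
   lies in a gap, the level curve of f through the point either stays in the gap strip while y
   traverses J, which the lower bound on |f_y / f_x| forbids, or leaves through a basic interval I_i
   with y still in J.  Exchanging the roles of x and y in I_i x J, the upper bound similarly leads to
   some I_i x J_j.  So f(I x J) is the union of the f(I_i x J_j), hence by compactness equals
   f((E1 x E2) Int (I x J)), and f(I x J) contains an interval. *)

theory Submission
  imports Defs
begin

section \<open>Basic intervals of a Moran structure\<close>

lemma words_0 [simp]: "words n 0 = {[]}"
  by (auto simp: words_def)

lemma words_Suc: "words n (Suc k) = (\<lambda>(\<sigma>, i). \<sigma> @ [i]) ` (words n k \<times> {1..n (Suc k)})"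
proof (intro equalityI subsetI)
  fix \<sigma> assume "\<sigma> \<in> words n (Suc k)"
  then have len: "length \<sigma> = Suc k" and le: "\<And>j. j < Suc k \<Longrightarrow> 1 \<le> \<sigma> ! j \<and> \<sigma> ! j \<le> n (Suc j)"
    by (auto simp: words_def)
  from len obtain \<tau> i where \<sigma>: "\<sigma> = \<tau> @ [i]" and \<tau>: "length \<tau> = k"
    by (metis length_Suc_conv_rev)
  have "\<tau> \<in> words n k"
    unfolding words_def
  proof (intro CollectI conjI allI impI)
    fix j assume "j < k"
    with le[of j] \<tau> show "1 \<le> \<tau> ! j" "\<tau> ! j \<le> n (Suc j)"
      by (auto simp: \<sigma> nth_append)
  qed (fact \<tau>)
  moreover have "i \<in> {1..n (Suc k)}"
    using le[of k] \<tau> by (simp add: \<sigma> nth_append)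
  ultimately show "\<sigma> \<in> (\<lambda>(\<sigma>, i). \<sigma> @ [i]) ` (words n k \<times> {1..n (Suc k)})"
    unfolding \<sigma> by force
next
  fix \<sigma> assume "\<sigma> \<in> (\<lambda>(\<sigma>, i). \<sigma> @ [i]) ` (words n k \<times> {1..n (Suc k)})"
  then show "\<sigma> \<in> words n (Suc k)"
    by (auto simp: words_def nth_append less_Suc_eq)
qed

lemma finite_words: "finite (words n k)"
  by (induction k) (auto simp: words_Suc)

lemma diameter_Icc: "a \<le> b \<Longrightarrow> diameter {a..b} = b - (a::real)"
  using diameter_cbox[of a b] by simp

lemma similitude_image_Icc:
  assumes "similitude S"
  obtains a b where "a < b" "S ` {0..1} = {a..b}"
proof -
  from assms obtain r where r: "r > 0" "\<And>x y. \<bar>S x - S y\<bar> = r * \<bar>x - y\<bar>"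
    unfolding similitude_def by blast
  have "r-lipschitz_on {0..1} S"
    using r by (intro lipschitz_onI) (auto simp: dist_real_def)
  then have cont: "continuous_on {0..1} S"
    by (rule lipschitz_on_continuous_on)
  then obtain a b where ab: "S ` {0..1} = {a..b}"
    using connected_compact_interval_1[of "S ` {0..1}"]
      connected_continuous_image[OF cont] compact_continuous_image[OF cont] by auto
  have "S 0 \<in> {a..b}" "S 1 \<in> {a..b}" "S 0 \<noteq> S 1"
    using r(2)[of 0 1] r(1) ab by auto
  then have "a < b" by auto
  with ab show thesis using that by blast
qed

lemma moran_structureD:
  assumes "moran_structure c n T" and \<sigma>: "\<sigma> \<in> words n k"
  shows moran_structure_similitude: "\<exists>S. similitude S \<and> S ` {0..1} = T \<sigma>"
    and moran_structure_subset: "i \<in> {1..n (Suc k)} \<Longrightarrow> T (\<sigma> @ [i]) \<subseteq> T \<sigma>"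
    and moran_structure_disjoint: "disjoint_family_on (\<lambda>i. interior (T (\<sigma> @ [i]))) {1..n (Suc k)}"
    and moran_structure_diameter:
      "i \<in> {1..n (Suc k)} \<Longrightarrow> diameter (T (\<sigma> @ [i])) / diameter (T \<sigma>) = c (Suc k)"
    and moran_structure_hull: "convex hull (\<Union>i\<in>{1..n (Suc k)}. T (\<sigma> @ [i])) = T \<sigma>"
proof -
  have *: "\<forall>k. \<forall>\<sigma>\<in>words n k. \<exists>S. similitude S \<and> S ` {0..1} = T \<sigma>"
    "\<forall>k. \<forall>\<sigma>\<in>words n k. (\<forall>i\<in>{1..n (Suc k)}. T (\<sigma> @ [i]) \<subseteq> T \<sigma>) \<and>
      disjoint_family_on (\<lambda>i. interior (T (\<sigma> @ [i]))) {1..n (Suc k)}"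
    "\<forall>k\<ge>1. \<forall>\<sigma>\<in>words n (k - 1).
      (\<forall>i\<in>{1..n k}. diameter (T (\<sigma> @ [i])) / diameter (T \<sigma>) = c k) \<and>
      convex hull (\<Union>i\<in>{1..n k}. T (\<sigma> @ [i])) = T \<sigma>"
    using assms(1) unfolding moran_structure_def by simp_all
  show "\<exists>S. similitude S \<and> S ` {0..1} = T \<sigma>"
    using *(1) \<sigma> by blast
  show "i \<in> {1..n (Suc k)} \<Longrightarrow> T (\<sigma> @ [i]) \<subseteq> T \<sigma>"
    "disjoint_family_on (\<lambda>i. interior (T (\<sigma> @ [i]))) {1..n (Suc k)}"
    using *(2) \<sigma> by blast+
  \<comment> \<open>Condition (3) is indexed by the order of the children, so it is taken at
    \<open>Suc k\<close> to speak about parents in \<open>words n k\<close>.\<close>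
  have "1 \<le> Suc k" "\<sigma> \<in> words n (Suc k - 1)"
    using \<sigma> by simp_all
  note ** = *(3)[rule_format, OF this]
  show "i \<in> {1..n (Suc k)} \<Longrightarrow> diameter (T (\<sigma> @ [i])) / diameter (T \<sigma>) = c (Suc k)"
    using conjunct1[OF **] by (rule bspec)
  show "convex hull (\<Union>i\<in>{1..n (Suc k)}. T (\<sigma> @ [i])) = T \<sigma>"
    using conjunct2[OF **] .
qed

text \<open>The similitude makes each set a nondegenerate compact interval. Since the ratio
  \<open>c k\<close> is the same for all siblings, lengths multiply along a word and depend on its
  order only.\<close>

lemma moran_structure_Icc:
  assumes M: "moran_structure c n T" and c: "\<And>k. k \<ge> 1 \<Longrightarrow> c k > 0" and \<sigma>: "\<sigma> \<in> words n k"
  shows "\<exists>a. T \<sigma> = {a..a + (\<Prod>j=1..k. c j)}"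
  using \<sigma>
proof (induction k arbitrary: \<sigma>)
  case 0
  then show ?case using M by (auto simp: moran_structure_def intro!: exI[of _ 0])
next
  case (Suc k)
  then obtain \<tau> i where \<tau>: "\<tau> \<in> words n k" and i: "i \<in> {1..n (Suc k)}" and \<sigma>: "\<sigma> = \<tau> @ [i]"
    by (auto simp: words_Suc)
  let ?L = "\<lambda>k. \<Prod>j=1..k. c j"
  have L: "?L k > 0" for k
    using c by (intro prod_pos) auto
  from Suc.IH[OF \<tau>] obtain a where "T \<tau> = {a..a + ?L k}" ..
  with L[of k] have d\<tau>: "diameter (T \<tau>) = ?L k"
    by (simp add: diameter_Icc)
  have "diameter (T \<sigma>) / diameter (T \<tau>) = c (Suc k)"
    using moran_structure_diameter[OF M \<tau> i] by (simp add: \<sigma>)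
  \<comment> \<open>Division by zero yields 0, so the ratio equation can be solved for the child's
    diameter only once the parent's is known to be nonzero.\<close>
  moreover have "diameter (T \<tau>) \<noteq> 0"
    using d\<tau> L[of k] by linarith
  ultimately have d\<sigma>: "diameter (T \<sigma>) = ?L (Suc k)"
    using d\<tau> by (simp add: nonzero_divide_eq_eq mult.commute)
  obtain S where "similitude S" "S ` {0..1} = T \<sigma>"
    using moran_structure_similitude[OF M Suc.prems] by blast
  then obtain b d where "b < d" "T \<sigma> = {b..d}"
    by (elim similitude_image_Icc) auto
  with d\<sigma> show ?case
    by (intro exI[of _ b]) (simp add: diameter_Icc)
qed

text \<open>The gap around \<open>x\<close> and the interiors of the intervals are disjoint subsets of \<open>{a..b}\<close>;
  compare Lebesgue measures.\<close>

lemma union_Icc_gap: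
  fixes a b d x :: real and J :: "'i \<Rightarrow> real set"
  assumes "finite I" and J: "\<And>i. i \<in> I \<Longrightarrow> \<exists>l. J i = {l..l + d}" and "d \<ge> 0"
    and disj: "disjoint_family_on (\<lambda>i. interior (J i)) I"
    and hull: "convex hull (\<Union>i\<in>I. J i) = {a..b}" and x: "x \<in> {a..b}"
  obtains u v where "u \<in> (\<Union>i\<in>I. J i)" "v \<in> (\<Union>i\<in>I. J i)" "u \<le> x" "x \<le> v"
    "v - u \<le> b - a - real (card I) * d"
proof -
  define K where "K = (\<Union>i\<in>I. J i)"
  have "compact K"
    unfolding K_def using \<open>finite I\<close> J by (metis compact_Icc compact_UN)
  have Ksub: "K \<subseteq> {a..b}"
    using hull hull_subset[of K convex] by (simp add: K_def)
  have conv: "{a..b} \<subseteq> S" if "K \<subseteq> S" "convex S" for S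
    using hull_minimal[of K S convex] that hull by (simp add: K_def)
  \<comment> \<open>By \<open>conv\<close>, every convex set containing \<open>K\<close> contains
    \<open>x\<close>, so neither open half-line at \<open>x\<close> can contain
    \<open>K\<close>.\<close>
  have "K \<inter> {..x} \<noteq> {}"
  proof
    assume "K \<inter> {..x} = {}"
    then have "K \<subseteq> {x<..}" by (auto simp: not_le)
    from conv[OF this] x show False by auto
  qed
  moreover have "K \<inter> {x..} \<noteq> {}"
  proof
    assume "K \<inter> {x..} = {}"
    then have "K \<subseteq> {..<x}" by (auto simp: not_le)
    from conv[OF this] x show False by auto
  qed
  moreover have "compact (K \<inter> {..x})" "compact (K \<inter> {x..})"
    using \<open>compact K\<close> by (auto intro: compact_Int_closed)
  \<comment> \<open>The nearest points of \<open>K\<close> on either side of \<open>x\<close>; both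
    equal \<open>x\<close> when \<open>x\<close> lies in \<open>K\<close>.\<close>
  ultimately obtain u v where u: "u \<in> K" "u \<le> x" "\<And>z. z \<in> K \<Longrightarrow> z \<le> x \<Longrightarrow> z \<le> u"
    and v: "v \<in> K" "x \<le> v" "\<And>z. z \<in> K \<Longrightarrow> x \<le> z \<Longrightarrow> v \<le> z"
    using compact_attains_sup[of "K \<inter> {..x}"] compact_attains_inf[of "K \<inter> {x..}"] by auto
  have gap: "{u<..<v} \<inter> K = {}"
    using u(3) v(3) by force
  \<comment> \<open>\<open>None\<close> indexes the gap and \<open>Some i\<close> the i-th interval,
    so that additivity applies to a single family. Interiors are used because only they are assumed
    disjoint; they still have measure \<open>d\<close>.\<close>
  define M where "M = case_option {u<..<v} (\<lambda>i. interior (J i))"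
  define I' where "I' = insert None (Some ` I)"
  have intJ: "interior (J i) \<inter> {u<..<v} = {}" if "i \<in> I" for i
    using gap that interior_subset[of "J i"] by (auto simp: K_def)
  have "disjoint_family_on M I'"
    using disj intJ by (auto simp: disjoint_family_on_def M_def I'_def)
  moreover have "M ` I' \<subseteq> sets lborel"
    by (auto simp: M_def I'_def)
  ultimately have "(\<Sum>i\<in>I'. emeasure lborel (M i)) = emeasure lborel (\<Union>i\<in>I'. M i)"
    using \<open>finite I\<close> by (intro sum_emeasure) (auto simp: I'_def)
  also have "\<dots> \<le> emeasure lborel {a..b}"
  proof (rule emeasure_mono)
    have "{u<..<v} \<subseteq> {a..b}"
      using subsetD[OF Ksub u(1)] subsetD[OF Ksub v(1)] by auto
    moreover have "interior (J i) \<subseteq> {a..b}" if "i \<in> I" for i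
      using Ksub that interior_subset[of "J i"] unfolding K_def by blast
    ultimately show "(\<Union>i\<in>I'. M i) \<subseteq> {a..b}"
      by (simp add: M_def I'_def UN_subset_iff)
  qed auto
  also have "\<dots> = ennreal (b - a)"
    using x by simp
  also have "(\<Sum>i\<in>I'. emeasure lborel (M i)) = ennreal (v - u) + (\<Sum>i\<in>I. emeasure lborel (interior (J i)))"
    using \<open>finite I\<close> u(2) v(2) by (simp add: I'_def M_def sum.reindex)
  also have "(\<Sum>i\<in>I. emeasure lborel (interior (J i))) = (\<Sum>i\<in>I. ennreal d)"
  proof (rule sum.cong)
    fix i assume "i \<in> I"
    with J obtain l where "J i = {l..l + d}" by blast
    then show "emeasure lborel (interior (J i)) = ennreal d"
      using \<open>d \<ge> 0\<close> by simp
  qed simp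
  also have "\<dots> = ennreal (real (card I) * d)"
    by (simp add: ennreal_mult' ennreal_of_nat_eq_real_of_nat)
  also have "ennreal (v - u) + \<dots> = ennreal (v - u + real (card I) * d)"
    using u(2) v(2) \<open>d \<ge> 0\<close> by (simp add: ennreal_plus)
  finally have "v - u + real (card I) * d \<le> b - a"
    using x by simp
  with u v show thesis
    by (intro that[of u v]) (auto simp: K_def)
qed

text \<open>The children fill the length L c_(k+1) n_(k+1) of a parent of length L, and
  \<open>union_Icc_gap\<close> bounds any single gap by the rest. A point already in a child is
  covered too, with a degenerate gap.\<close>

lemma moran_structure_gap:
  assumes M: "moran_structure c n T" and c: "\<And>k. k \<ge> 1 \<Longrightarrow> c k > 0"
    and \<sigma>: "\<sigma> \<in> words n k" and x: "x \<in> T \<sigma>"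
  obtains i i' u v where "i \<in> {1..n (Suc k)}" "i' \<in> {1..n (Suc k)}"
    "u \<in> T (\<sigma> @ [i])" "v \<in> T (\<sigma> @ [i'])" "u \<le> x" "x \<le> v"
    "v - u \<le> (\<Prod>j=1..k. c j) * (1 - c (Suc k) * real (n (Suc k)))"
proof -
  let ?L = "\<lambda>k. \<Prod>j=1..k. c j"
  have L: "?L k \<ge> 0" for k
    using c by (intro prod_nonneg) (auto intro: less_imp_le)
  obtain a where a: "T \<sigma> = {a..a + ?L k}"
    using moran_structure_Icc[OF M c \<sigma>] by blast
  have "\<sigma> @ [i] \<in> words n (Suc k)" if "i \<in> {1..n (Suc k)}" for i
    using \<sigma> that unfolding words_Suc by force
  then have J: "\<exists>l. T (\<sigma> @ [i]) = {l..l + ?L (Suc k)}" if "i \<in> {1..n (Suc k)}" for i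
    using moran_structure_Icc[OF M c] that by blast
  have disj: "disjoint_family_on (\<lambda>i. interior (T (\<sigma> @ [i]))) {1..n (Suc k)}"
    by (rule moran_structure_disjoint[OF M \<sigma>])
  have hull: "convex hull (\<Union>i\<in>{1..n (Suc k)}. T (\<sigma> @ [i])) = {a..a + ?L k}"
    using moran_structure_hull[OF M \<sigma>] by (simp only: a)
  obtain u v where uv: "u \<in> (\<Union>i\<in>{1..n (Suc k)}. T (\<sigma> @ [i]))" "v \<in> (\<Union>i\<in>{1..n (Suc k)}. T (\<sigma> @ [i]))"
      "u \<le> x" "x \<le> v" "v - u \<le> a + ?L k - a - real (card {1..n (Suc k)}) * ?L (Suc k)"
    by (rule union_Icc_gap[OF finite_atLeastAtMost J L disj hull]) (use x a in auto)
  from uv(1,2) obtain i i' where "i \<in> {1..n (Suc k)}" "i' \<in> {1..n (Suc k)}"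
    "u \<in> T (\<sigma> @ [i])" "v \<in> T (\<sigma> @ [i'])" by blast
  moreover have "v - u \<le> ?L k * (1 - c (Suc k) * real (n (Suc k)))"
    using uv(5) by (simp add: algebra_simps)
  ultimately show thesis
    using uv(3,4) that by blast
qed

section \<open>Levels of the construction\<close>

definition moran_level :: "(nat \<Rightarrow> nat) \<Rightarrow> (nat list \<Rightarrow> real set) \<Rightarrow> nat \<Rightarrow> real set" where
  "moran_level n T k = (\<Union>\<sigma>\<in>words n k. T \<sigma>)"

lemma closed_moran_level:
  assumes "moran_structure c n T" "\<And>k. k \<ge> 1 \<Longrightarrow> c k > 0"
  shows "closed (moran_level n T k)"
  unfolding moran_level_def
proof (rule closed_UN[OF finite_words], rule ballI)
  fix \<sigma> assume "\<sigma> \<in> words n k"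
  from moran_structure_Icc[OF assms this] obtain a where "T \<sigma> = {a..a + (\<Prod>j=1..k. c j)}"
    by blast
  then show "closed (T \<sigma>)" by simp
qed

lemma decseq_moran_level:
  assumes "moran_structure c n T"
  shows "decseq (moran_level n T)"
proof (intro decseq_SucI subsetI)
  fix k x assume "x \<in> moran_level n T (Suc k)"
  then obtain \<sigma> i where "\<sigma> \<in> words n k" "i \<in> {1..n (Suc k)}" "x \<in> T (\<sigma> @ [i])"
    unfolding moran_level_def words_Suc by auto
  then show "x \<in> moran_level n T k"
    using moran_structure_subset[OF assms, of \<sigma> k i] unfolding moran_level_def by blast
qed

section \<open>Moving points off the gaps along level curves\<close>

text \<open>Intermediate values in contrapositive form; going through connectedness of the image
  leaves the order of \<open>y\<close> and \<open>z\<close> free.\<close>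

lemma connected_ivt:
  fixes g :: "real \<Rightarrow> real"
  assumes "continuous_on {p..q} g" "y \<in> {p..q}" "z \<in> {p..q}" "g y < t" "\<forall>w\<in>{p..q}. g w \<noteq> t"
  shows "g z < t"
proof (rule ccontr)
  assume "\<not> g z < t"
  then have "t \<in> {g y..g z}" using assms(4) by auto
  moreover have "connected (g ` {p..q})"
    using assms(1) by (intro connected_continuous_image) auto
  ultimately have "t \<in> g ` {p..q}"
    using assms(2,3) connected_contains_Icc[of "g ` {p..q}" "g y" "g z"] by blast
  with assms(5) show False by auto
qed

text \<open>If neither edge attains \<open>t\<close>, then \<open>h u\<close> stays below
  \<open>t\<close> and \<open>h v\<close> above it on all of \<open>{p..q}\<close>. Being within
  \<open>D\<close> of \<open>h v\<close>, the values of \<open>h u\<close> at \<open>p\<close> and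
  \<open>q\<close> lie strictly between \<open>t - D\<close> and \<open>t\<close>, contradicting
  \<open>lower\<close>.\<close>

lemma fill_gap_aux:
  fixes h :: "real \<Rightarrow> real \<Rightarrow> real"
  assumes cont: "continuous_on {p..q} (h u)" "continuous_on {p..q} (h v)"
    and y: "y \<in> {p..q}"
    and upper: "\<And>y. y \<in> {p..q} \<Longrightarrow> \<bar>h v y - h u y\<bar> \<le> D" and lower: "\<bar>h u q - h u p\<bar> \<ge> D"
    and t: "h u y < t" "t < h v y"
  shows "\<exists>x'\<in>{u, v}. \<exists>y'\<in>{p..q}. h x' y' = t"
proof (rule ccontr)
  assume neg: "\<not> ?thesis"
  have "h u z < t" if "z \<in> {p..q}" for z
    using connected_ivt[OF cont(1) y that t(1)] neg by auto
  moreover have "t < h v z" if "z \<in> {p..q}" for z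
    using connected_ivt[of p q "\<lambda>z. - h v z" y z "- t"] cont(2) y that t(2) neg
    by (auto intro: continuous_on_minus)
  moreover have "p \<in> {p..q}" "q \<in> {p..q}"
    using y by auto
  ultimately have "h u p < t" "h u q < t" "t < h v p" "t < h v q"
    "\<bar>h v p - h u p\<bar> \<le> D" "\<bar>h v q - h u q\<bar> \<le> D"
    using upper by blast+
  with lower show False by linarith
qed

text \<open>\<open>A\<close> limits the change of \<open>h\<close> across the gap and
  \<open>B\<close> forces a change along \<open>{p..q}\<close>; by \<open>AB\<close> a level curve
  cannot run along the whole strip without meeting an edge. The function is curried so that the two
  variables can be exchanged.\<close>

lemma fill_gap:
  fixes h :: "real \<Rightarrow> real \<Rightarrow> real"
  assumes X: "{u..v} \<subseteq> X" and Y: "{p..q} \<subseteq> Y" and x: "u \<le> x" "x \<le> v" and y: "y \<in> {p..q}"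
    and cont: "\<And>x. x \<in> X \<Longrightarrow> continuous_on Y (h x)" "\<And>y. y \<in> Y \<Longrightarrow> continuous_on X (\<lambda>x. h x y)"
    and inj: "\<And>y. y \<in> Y \<Longrightarrow> inj_on (\<lambda>x. h x y) X"
    and upper: "\<And>x x' y. x \<in> X \<Longrightarrow> x' \<in> X \<Longrightarrow> y \<in> Y \<Longrightarrow> \<bar>h x y - h x' y\<bar> \<le> A * \<bar>x - x'\<bar>"
    and lower: "\<And>x y y'. x \<in> X \<Longrightarrow> y \<in> Y \<Longrightarrow> y' \<in> Y \<Longrightarrow> \<bar>h x y - h x y'\<bar> \<ge> B * \<bar>y - y'\<bar>"
    and AB: "A * (v - u) \<le> B * (q - p)"
  shows "\<exists>x'\<in>{u, v}. \<exists>y'\<in>{p..q}. h x' y' = h x y"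
proof (cases "x = u \<or> x = v")
  case True
  then show ?thesis using y by blast
next
  case False
  with x have xuv: "u < x" "x < v" by auto
  then have uvX: "u \<in> X" "v \<in> X" using X by auto
  have pq: "p \<le> q" "p \<in> Y" "q \<in> Y" "y \<in> Y" using y Y by auto
  \<comment> \<open>A continuous injective function is strictly monotone, so the value at
    \<open>x\<close> lies strictly between the edge values. The two possible orders correspond to
    the two uses of \<open>fill_gap_aux\<close> below.\<close>
  have "h u y < h x y \<and> h x y < h v y \<or> h v y < h x y \<and> h x y < h u y"
    using continuous_inj_imp_mono[OF xuv, of "\<lambda>x. h x y"] pq(4) X
      continuous_on_subset[OF cont(2)] inj_on_subset[OF inj] by auto
  moreover have c: "continuous_on {p..q} (h w)" if "w \<in> X" for w
    using continuous_on_subset[OF cont(1)[OF that] Y] .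
  moreover have "\<bar>h v z - h u z\<bar> \<le> A * (v - u)" "\<bar>h u z - h v z\<bar> \<le> A * (v - u)" if "z \<in> {p..q}" for z
    using upper[of v u z] upper[of u v z] uvX that Y x by auto
  moreover have "\<bar>h w q - h w p\<bar> \<ge> A * (v - u)" if "w \<in> X" for w
    using lower[of w q p] that pq AB by simp
  ultimately show ?thesis
    using fill_gap_aux[of p q h u v y "A * (v - u)" "h x y"]
      fill_gap_aux[of p q h v u y "A * (v - u)" "h x y"] uvX y by blast
qed

section \<open>Images of basic squares\<close>

text \<open>The two conditions \<open>ab\<close> differ because of the order of the moves. While
  \<open>x\<close> leaves its gap, \<open>y\<close> may run through the whole parent of length L;
  afterwards \<open>x\<close> must remain in the child just reached, so only the length L c_(k+1) is
  available while \<open>y\<close> leaves its gap.\<close>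

lemma basic_square_refine:
  fixes h :: "real \<Rightarrow> real \<Rightarrow> real"
  assumes M: "moran_structure c n T1" "moran_structure c n T2"
    and c: "\<And>k. k \<ge> 1 \<Longrightarrow> c k > 0"
    and \<sigma>: "\<sigma> \<in> words n k" and \<tau>: "\<tau> \<in> words n k"
    and sub: "T1 \<sigma> \<subseteq> X" "T2 \<tau> \<subseteq> Y"
    and cont: "\<And>x. x \<in> X \<Longrightarrow> continuous_on Y (h x)" "\<And>y. y \<in> Y \<Longrightarrow> continuous_on X (\<lambda>x. h x y)"
    and pos: "a1 > 0" "a2 > 0" "b1 > 0" "b2 > 0"
    and h1: "\<And>x x' y. x \<in> X \<Longrightarrow> x' \<in> X \<Longrightarrow> y \<in> Y \<Longrightarrow>
      a1 * \<bar>x - x'\<bar> \<le> \<bar>h x y - h x' y\<bar> \<and> \<bar>h x y - h x' y\<bar> \<le> a2 * \<bar>x - x'\<bar>"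
    and h2: "\<And>x y y'. x \<in> X \<Longrightarrow> y \<in> Y \<Longrightarrow> y' \<in> Y \<Longrightarrow>
      b1 * \<bar>y - y'\<bar> \<le> \<bar>h x y - h x y'\<bar> \<and> \<bar>h x y - h x y'\<bar> \<le> b2 * \<bar>y - y'\<bar>"
    and ab: "a2 * (1 - c (Suc k) * real (n (Suc k))) \<le> b1"
      "b2 * (1 - c (Suc k) * real (n (Suc k))) \<le> a1 * c (Suc k)"
    and x: "x \<in> T1 \<sigma>" and y: "y \<in> T2 \<tau>"
  obtains i j x' y' where "i \<in> {1..n (Suc k)}" "j \<in> {1..n (Suc k)}"
    "x' \<in> T1 (\<sigma> @ [i])" "y' \<in> T2 (\<tau> @ [j])" "h x' y' = h x y"
proof -
  define L where "L = (\<Prod>j=1..k. c j)"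
  define G where "G = L * (1 - c (Suc k) * real (n (Suc k)))"
  have L: "L > 0"
    unfolding L_def using c by (intro prod_pos) auto
  have LS: "(\<Prod>j=1..Suc k. c j) = L * c (Suc k)"
    by (simp add: L_def)
  have inj1: "inj_on (\<lambda>x. h x y) X" if "y \<in> Y" for y
  proof (rule inj_onI)
    fix x x' assume "x \<in> X" "x' \<in> X" "h x y = h x' y"
    with h1[of x x' y] that pos(1) show "x = x'" by (simp add: mult_le_0_iff)
  qed
  have inj2: "inj_on (h x) Y" if "x \<in> X" for x
  proof (rule inj_onI)
    fix y y' assume "y \<in> Y" "y' \<in> Y" "h x y = h x y'"
    with h2[of x y y'] that pos(3) show "y = y'" by (simp add: mult_le_0_iff)
  qed
  obtain p where p: "T2 \<tau> = {p..p + L}"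
    using moran_structure_Icc[OF M(2) c \<tau>] unfolding L_def by blast
  obtain s where s: "T1 \<sigma> = {s..s + L}"
    using moran_structure_Icc[OF M(1) c \<sigma>] unfolding L_def by blast
  have sub1: "T1 (\<sigma> @ [i]) \<subseteq> T1 \<sigma>" if "i \<in> {1..n (Suc k)}" for i
    using moran_structure_subset[OF M(1) \<sigma> that] .
  have sub2: "T2 (\<tau> @ [i]) \<subseteq> T2 \<tau>" if "i \<in> {1..n (Suc k)}" for i
    using moran_structure_subset[OF M(2) \<tau> that] .
  obtain i i' u v where i: "i \<in> {1..n (Suc k)}" "i' \<in> {1..n (Suc k)}"
    and uv: "u \<in> T1 (\<sigma> @ [i])" "v \<in> T1 (\<sigma> @ [i'])" "u \<le> x" "x \<le> v" and G1: "v - u \<le> G"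
    unfolding G_def L_def by (rule moran_structure_gap[OF M(1) c \<sigma> x])
  have "\<exists>x'\<in>{u, v}. \<exists>y'\<in>{p..p + L}. h x' y' = h x y"
  proof (rule fill_gap[where X = X and Y = Y and A = a2 and B = b1])
    show "{u..v} \<subseteq> X"
      using uv(1,2) sub1[OF i(1)] sub1[OF i(2)] sub(1) s by fastforce
    \<comment> \<open>Both sides are compared with \<open>a2 * G\<close>.\<close>
    show "a2 * (v - u) \<le> b1 * (p + L - p)"
      using mult_left_mono[OF G1, of a2] mult_left_mono[OF ab(1), of L] pos L
      by (simp add: G_def algebra_simps)
  qed (use uv p sub y cont inj1 h1 h2 in auto)
  then obtain x1 y1 l where l: "l \<in> {1..n (Suc k)}" "x1 \<in> T1 (\<sigma> @ [l])"
    and y1: "y1 \<in> T2 \<tau>" and eq1: "h x1 y1 = h x y"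
    using uv i p by auto
  have "\<sigma> @ [l] \<in> words n (Suc k)"
    using \<sigma> l(1) unfolding words_Suc by force
  then obtain m where m: "T1 (\<sigma> @ [l]) = {m..m + L * c (Suc k)}"
    using moran_structure_Icc[OF M(1) c, where k = "Suc k"] unfolding LS by blast
  obtain j j' u v where j: "j \<in> {1..n (Suc k)}" "j' \<in> {1..n (Suc k)}"
    and uv: "u \<in> T2 (\<tau> @ [j])" "v \<in> T2 (\<tau> @ [j'])" "u \<le> y1" "y1 \<le> v" and G2: "v - u \<le> G"
    unfolding G_def L_def by (rule moran_structure_gap[OF M(2) c \<tau> y1])
  \<comment> \<open>Second move, with the variables exchanged: \<open>x'\<close> ranges only over
    \<open>T1 (\<sigma> @ [l])\<close>, so what the first move gained is kept.\<close>
  have "\<exists>y'\<in>{u, v}. \<exists>x'\<in>{m..m + L * c (Suc k)}. h x' y' = h x1 y1"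
  proof (rule fill_gap[where h = "\<lambda>y x. h x y" and X = Y and Y = X and A = b2 and B = a1])
    show "{u..v} \<subseteq> Y"
      using uv(1,2) sub2[OF j(1)] sub2[OF j(2)] sub(2) p by fastforce
    show "{m..m + L * c (Suc k)} \<subseteq> X"
      using m sub1[OF l(1)] sub(1) by auto
    show "b2 * (v - u) \<le> a1 * (m + L * c (Suc k) - m)"
      using mult_left_mono[OF G2, of b2] mult_left_mono[OF ab(2), of L] pos L
      by (simp add: G_def algebra_simps)
  qed (use uv m l cont inj2 h1 h2 in auto)
  then show thesis
    using uv j m l(1) eq1 that by auto
qed

text \<open>Repeated refinement gives, at each order from \<open>k\<close> on, a square inside the
  initial one that meets the fibre of \<open>t\<close>; compactness then yields a point of the fibre
  lying in all levels.\<close>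

lemma basic_square_image:
  fixes f :: "real \<times> real \<Rightarrow> real"
  assumes M: "moran_structure c n T1" "moran_structure c n T2"
    and c: "\<And>k. k \<ge> 1 \<Longrightarrow> c k > 0"
    and \<sigma>: "\<sigma> \<in> words n k" and \<tau>: "\<tau> \<in> words n k"
    and sub: "T1 \<sigma> \<subseteq> X" "T2 \<tau> \<subseteq> Y"
    and cont: "continuous_on (X \<times> Y) f"
    and pos: "a1 > 0" "a2 > 0" "b1 > 0" "b2 > 0"
    and h1: "\<And>x x' y. x \<in> X \<Longrightarrow> x' \<in> X \<Longrightarrow> y \<in> Y \<Longrightarrow>
      a1 * \<bar>x - x'\<bar> \<le> \<bar>f (x, y) - f (x', y)\<bar> \<and> \<bar>f (x, y) - f (x', y)\<bar> \<le> a2 * \<bar>x - x'\<bar>"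
    and h2: "\<And>x y y'. x \<in> X \<Longrightarrow> y \<in> Y \<Longrightarrow> y' \<in> Y \<Longrightarrow>
      b1 * \<bar>y - y'\<bar> \<le> \<bar>f (x, y) - f (x, y')\<bar> \<and> \<bar>f (x, y) - f (x, y')\<bar> \<le> b2 * \<bar>y - y'\<bar>"
    and ab: "\<And>k. k \<ge> 1 \<Longrightarrow> a2 * (1 - c k * real (n k)) \<le> b1"
      "\<And>k. k \<ge> 1 \<Longrightarrow> b2 * (1 - c k * real (n k)) \<le> a1 * c k"
  shows "f ` (T1 \<sigma> \<times> T2 \<tau>) \<subseteq>
    f ` (T1 \<sigma> \<times> T2 \<tau> \<inter> (\<Inter>k\<in>{1..}. moran_level n T1 k) \<times> (\<Inter>k\<in>{1..}. moran_level n T2 k))"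
proof
  fix t assume t: "t \<in> f ` (T1 \<sigma> \<times> T2 \<tau>)"
  define Q where "Q = T1 \<sigma> \<times> T2 \<tau>"
  \<comment> \<open>The squares found at successive orders are not recorded as nested, so
    \<open>C m\<close> keeps only membership in the levels, which decrease by themselves.\<close>
  define C where "C m = (Q \<inter> f -` {t}) \<inter> (moran_level n T1 (k + m) \<times> moran_level n T2 (k + m))" for m
  have contx: "continuous_on Y (\<lambda>y. f (x, y))" if "x \<in> X" for x
    by (rule continuous_on_compose2[OF cont]) (auto intro!: continuous_intros simp: that)
  have conty: "continuous_on X (\<lambda>x. f (x, y))" if "y \<in> Y" for y
    by (rule continuous_on_compose2[OF cont]) (auto intro!: continuous_intros simp: that)
  \<comment> \<open>Inclusion in the initial square is carried along because the estimates on
    \<open>f\<close> are assumed only over \<open>X\<close> and \<open>Y\<close>.\<close>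
  have "\<exists>\<sigma>'\<in>words n (k + m). \<exists>\<tau>'\<in>words n (k + m). T1 \<sigma>' \<subseteq> T1 \<sigma> \<and> T2 \<tau>' \<subseteq> T2 \<tau> \<and>
      t \<in> f ` (T1 \<sigma>' \<times> T2 \<tau>')" for m
  proof (induction m)
    case 0
    then show ?case using \<sigma> \<tau> t by auto
  next
    case (Suc m)
    then obtain \<sigma>' \<tau>' x y where w: "\<sigma>' \<in> words n (k + m)" "\<tau>' \<in> words n (k + m)"
      and s: "T1 \<sigma>' \<subseteq> T1 \<sigma>" "T2 \<tau>' \<subseteq> T2 \<tau>" and x: "x \<in> T1 \<sigma>'" and y: "y \<in> T2 \<tau>'" and xy: "f (x, y) = t"
      by blast
    have subX: "T1 \<sigma>' \<subseteq> X" "T2 \<tau>' \<subseteq> Y"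
      using s sub by auto
    obtain i j x' y' where ij: "i \<in> {1..n (Suc (k + m))}" "j \<in> {1..n (Suc (k + m))}"
      "x' \<in> T1 (\<sigma>' @ [i])" "y' \<in> T2 (\<tau>' @ [j])" "f (x', y') = f (x, y)"
      by (rule basic_square_refine[where h = "\<lambda>x y. f (x, y)", OF M c w subX contx conty pos h1 h2 _ _ x y])
        (auto intro!: ab)
    have "\<sigma>' @ [i] \<in> words n (k + Suc m)" "\<tau>' @ [j] \<in> words n (k + Suc m)"
      using w ij(1,2) by (auto simp: words_Suc)
    moreover have "T1 (\<sigma>' @ [i]) \<subseteq> T1 \<sigma>'" "T2 (\<tau>' @ [j]) \<subseteq> T2 \<tau>'"
      using moran_structure_subset M w ij(1,2) by blast+
    moreover have "t \<in> f ` (T1 (\<sigma>' @ [i]) \<times> T2 (\<tau>' @ [j]))"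
      using ij(3-5) xy by (intro image_eqI[of _ _ "(x', y')"]) auto
    ultimately show ?case
      using s by blast
  qed
  then have "C m \<noteq> {}" for m
    unfolding C_def Q_def moran_level_def by fastforce
  moreover have "compact (C m)" for m
  proof -
    have "compact Q"
      unfolding Q_def using moran_structure_Icc[OF M(1) c \<sigma>] moran_structure_Icc[OF M(2) c \<tau>]
      by (metis compact_Icc compact_Times)
    moreover have "closed (Q \<inter> f -` {t})"
      using \<open>compact Q\<close> sub
      by (intro continuous_closed_preimage continuous_on_subset[OF cont] compact_imp_closed)
        (auto simp: Q_def)
    ultimately have "compact (Q \<inter> f -` {t})"
      using compact_Int_closed[of Q "Q \<inter> f -` {t}"] by (simp flip: Int_assoc)
    moreover have "closed (moran_level n T1 (k + m) \<times> moran_level n T2 (k + m))"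
      using M c by (intro closed_Times closed_moran_level)
    ultimately show ?thesis
      unfolding C_def by (rule compact_Int_closed)
  qed
  moreover have "C m \<subseteq> C l" if "l \<le> m" for l m
    unfolding C_def
    using decseqD[OF decseq_moran_level[OF M(1)], of "k + l" "k + m"]
      decseqD[OF decseq_moran_level[OF M(2)], of "k + l" "k + m"] that by auto
  ultimately have "\<Inter> (range C) \<noteq> {}"
    by (intro compact_nest) auto
  then obtain x y where xy: "\<And>m. (x, y) \<in> C m"
    by auto
  \<comment> \<open>The nest starts at order \<open>k\<close>; all levels are reached because level
    \<open>j\<close> contains level \<open>k + j\<close>.\<close>
  have "x \<in> moran_level n T1 j" "y \<in> moran_level n T2 j" for j
    using xy[of j] decseqD[OF decseq_moran_level[OF M(1)], of j "k + j"]
      decseqD[OF decseq_moran_level[OF M(2)], of j "k + j"] by (auto simp: C_def)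
  with xy[of 0] show "t \<in> f ` (T1 \<sigma> \<times> T2 \<tau> \<inter>
      (\<Inter>k\<in>{1..}. moran_level n T1 k) \<times> (\<Inter>k\<in>{1..}. moran_level n T2 k))"
    by (intro image_eqI[of _ _ "(x, y)"]) (auto simp: C_def Q_def)
qed

section \<open>The mean value theorem near the base point\<close>

lemma mvt_abs_bounds:
  fixes g :: "real \<Rightarrow> real"
  assumes diff: "\<And>z. z \<in> {l..r} \<Longrightarrow> g differentiable (at z)"
    and d: "\<And>z. z \<in> {l..r} \<Longrightarrow> \<bar>deriv g z - a\<bar> < e"
    and x: "x \<in> {l..r}" "x' \<in> {l..r}"
  shows "(\<bar>a\<bar> - e) * \<bar>x - x'\<bar> \<le> \<bar>g x - g x'\<bar> \<and> \<bar>g x - g x'\<bar> \<le> (\<bar>a\<bar> + e) * \<bar>x - x'\<bar>"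
proof -
  have *: "(\<bar>a\<bar> - e) * \<bar>x - x'\<bar> \<le> \<bar>g x - g x'\<bar> \<and> \<bar>g x - g x'\<bar> \<le> (\<bar>a\<bar> + e) * \<bar>x - x'\<bar>"
    if xx: "x < x'" "x \<in> {l..r}" "x' \<in> {l..r}" for x x'
  proof -
    have "DERIV g z :> deriv g z" if "x \<le> z" "z \<le> x'" for z
      using diff[of z] that xx by (simp add: DERIV_deriv_iff_real_differentiable)
    with xx(1) obtain z where z: "x < z" "z < x'" "g x' - g x = (x' - x) * deriv g z"
      using MVT2[of x x' g "deriv g"] by blast
    then have "\<bar>g x - g x'\<bar> = \<bar>deriv g z\<bar> * \<bar>x - x'\<bar>"
      by (metis abs_minus_commute abs_mult mult.commute)
    moreover have "\<bar>a\<bar> - e \<le> \<bar>deriv g z\<bar>" "\<bar>deriv g z\<bar> \<le> \<bar>a\<bar> + e"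
      using d[of z] z xx by auto
    ultimately show ?thesis
      by (simp add: mult_right_mono)
  qed
  consider "x < x'" | "x' < x" | "x = x'" by linarith
  then show ?thesis
    using *[of x x'] *[of x' x] x by cases (auto simp: abs_minus_commute)
qed

text \<open>Continuity at the base point keeps both partials within \<open>e\<close> of their values
  there on a small square, where \<open>mvt_abs_bounds\<close> applies to the sections of
  \<open>f\<close>.\<close>

lemma continuous_partials_box:
  fixes f :: "real \<times> real \<Rightarrow> real"
  assumes hc: "has_continuous_partials_at f (x0, y0)" and "open U" "(x0, y0) \<in> U" "e > 0"
  obtains r where "r > 0" "{x0 - r..x0 + r} \<times> {y0 - r..y0 + r} \<subseteq> U"
    "\<And>x x' y. x \<in> {x0 - r..x0 + r} \<Longrightarrow> x' \<in> {x0 - r..x0 + r} \<Longrightarrow> y \<in> {y0 - r..y0 + r} \<Longrightarrow>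
      (\<bar>partial_x f (x0, y0)\<bar> - e) * \<bar>x - x'\<bar> \<le> \<bar>f (x, y) - f (x', y)\<bar> \<and>
      \<bar>f (x, y) - f (x', y)\<bar> \<le> (\<bar>partial_x f (x0, y0)\<bar> + e) * \<bar>x - x'\<bar>"
    "\<And>x y y'. x \<in> {x0 - r..x0 + r} \<Longrightarrow> y \<in> {y0 - r..y0 + r} \<Longrightarrow> y' \<in> {y0 - r..y0 + r} \<Longrightarrow>
      (\<bar>partial_y f (x0, y0)\<bar> - e) * \<bar>y - y'\<bar> \<le> \<bar>f (x, y) - f (x, y')\<bar> \<and>
      \<bar>f (x, y) - f (x, y')\<bar> \<le> (\<bar>partial_y f (x0, y0)\<bar> + e) * \<bar>y - y'\<bar>"
proof -
  let ?p = "(x0, y0)"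
  have "\<forall>\<^sub>F q in nhds ?p. q \<in> U"
    using assms(2,3) by (rule eventually_nhds_in_open)
  moreover have "\<forall>\<^sub>F q in nhds ?p. dist (partial_x f q) (partial_x f ?p) < e"
    using hc \<open>e > 0\<close> unfolding has_continuous_partials_at_def
    by (intro tendstoD) (auto simp: isCont_def tendsto_at_iff_tendsto_nhds)
  moreover have "\<forall>\<^sub>F q in nhds ?p. dist (partial_y f q) (partial_y f ?p) < e"
    using hc \<open>e > 0\<close> unfolding has_continuous_partials_at_def
    by (intro tendstoD) (auto simp: isCont_def tendsto_at_iff_tendsto_nhds)
  moreover have "\<forall>\<^sub>F q in nhds ?p. (\<lambda>x. f (x, snd q)) differentiable (at (fst q)) \<and>
      (\<lambda>y. f (fst q, y)) differentiable (at (snd q))"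
    using hc unfolding has_continuous_partials_at_def by blast
  ultimately have "\<forall>\<^sub>F q in nhds ?p. q \<in> U \<and> dist (partial_x f q) (partial_x f ?p) < e \<and>
      dist (partial_y f q) (partial_y f ?p) < e \<and>
      (\<lambda>x. f (x, snd q)) differentiable (at (fst q)) \<and> (\<lambda>y. f (fst q, y)) differentiable (at (snd q))"
    by eventually_elim blast
  then obtain d where d: "d > 0" "\<And>q. dist q ?p < d \<Longrightarrow> q \<in> U \<and>
      dist (partial_x f q) (partial_x f ?p) < e \<and> dist (partial_y f q) (partial_y f ?p) < e \<and>
      (\<lambda>x. f (x, snd q)) differentiable (at (fst q)) \<and> (\<lambda>y. f (fst q, y)) differentiable (at (snd q))"
    unfolding eventually_nhds_metric by blast
  \<comment> \<open>The coordinate distances then sum to at most 2d/3, so the closed square lies in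
    the open ball of radius \<open>d\<close>.\<close>
  define r where "r = d / 3"
  let ?X = "{x0 - r..x0 + r}" and ?Y = "{y0 - r..y0 + r}"
  have "dist (x, y) ?p < d" if "x \<in> ?X" "y \<in> ?Y" for x y
  proof -
    have "dist (x, y) ?p \<le> \<bar>x - x0\<bar> + \<bar>y - y0\<bar>"
      using sqrt_sum_squares_le_sum_abs[of "x - x0" "y - y0"] by (simp add: dist_Pair_Pair dist_real_def)
    also have "\<dots> < d" using that d(1) by (auto simp: r_def)
    finally show ?thesis .
  qed
  then have box: "(x, y) \<in> U" "\<bar>deriv (\<lambda>x. f (x, y)) x - partial_x f ?p\<bar> < e"
      "\<bar>deriv (\<lambda>y. f (x, y)) y - partial_y f ?p\<bar> < e"
      "(\<lambda>x. f (x, y)) differentiable (at x)" "(\<lambda>y. f (x, y)) differentiable (at y)"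
    if "x \<in> ?X" "y \<in> ?Y" for x y
    using d(2)[of "(x, y)"] that by (auto simp: dist_real_def partial_x_def partial_y_def)
  show thesis
  proof (rule that[of r])
    show "r > 0" using d(1) by (simp add: r_def)
    show "?X \<times> ?Y \<subseteq> U" using box(1) by blast
  qed (rule mvt_abs_bounds; use box in blast)+
qed

section \<open>Small basic squares and the conclusion\<close>

text \<open>As n_k >= 2 and c_k n_k < 1, each ratio is at most 1/2 and the sides decay
  geometrically. The order is at least 1 because \<open>E1\<close> and \<open>E2\<close> are
  intersections of levels from 1 on.\<close>

lemma moran_side_less:
  assumes n: "\<And>k. k \<ge> 1 \<Longrightarrow> n k \<ge> 2" and c: "\<And>k. k \<ge> 1 \<Longrightarrow> c k > 0"
    and cn: "\<And>k. k \<ge> 1 \<Longrightarrow> c k * real (n k) < 1" and "r > 0"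
  obtains k :: nat where "k \<ge> 1" "(\<Prod>j=1..k. c j) < r"
proof -
  have half: "c k \<le> 1 / 2" if "k \<ge> 1" for k
  proof -
    have "c k * 2 \<le> c k * real (n k)"
      using n[OF that] c[OF that] by (intro mult_left_mono) auto
    with cn[OF that] show ?thesis by simp
  qed
  obtain m where m: "(1 / 2) ^ m < r"
    using real_arch_pow_inv[of r "1 / 2"] \<open>r > 0\<close> by auto
  have "(\<Prod>j=1..Suc m. c j) \<le> (\<Prod>j=1..Suc m. 1 / 2)"
    using c half by (intro prod_mono) (auto intro: less_imp_le)
  also have "\<dots> = (1 / 2) ^ Suc m"
    by (simp add: prod_constant)
  also have "\<dots> \<le> (1 / 2) ^ m"
    by simp
  finally show thesis
    using m that[of "Suc m"] by simp
qed

theorem theorem1p1: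
  fixes n :: "nat \<Rightarrow> nat" and c :: "nat \<Rightarrow> real"
    and E1 E2 :: "real set"
    and f :: "real \<times> real \<Rightarrow> real" and U :: "(real \<times> real) set"
  assumes "\<And>k. k \<ge> 1 \<Longrightarrow> n k \<ge> 2"
    and "\<And>k. k \<ge> 1 \<Longrightarrow> c k > 0"
    and "\<And>k. k \<ge> 1 \<Longrightarrow> c k * real (n k) < 1"
    and "E1 \<in> moran_sets c n" and "E2 \<in> moran_sets c n"
    and "open U" and "continuous_on U f"
    and "\<exists>x0 y0. (x0, y0) \<in> (E1 \<times> E2) \<inter> U \<and>
           has_continuous_partials_at f (x0, y0) \<and>
           (SUP k\<in>{1..}. 1 - c k * real (n k))
             < \<bar>partial_y f (x0, y0) / partial_x f (x0, y0)\<bar> \<and>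
           \<bar>partial_y f (x0, y0) / partial_x f (x0, y0)\<bar>
             < (INF k\<in>{1..}. c k / (1 - real (n k) * c k))"
  shows "interior {f (x, y) | x y. (x, y) \<in> (E1 \<times> E2) \<inter> U} \<noteq> {}"
proof -
  define s where "s = (SUP k\<in>{1..}. 1 - c k * real (n k))"
  define q where "q = (INF k\<in>{1..}. c k / (1 - real (n k) * c k))"
  obtain x0 y0 where p: "x0 \<in> E1" "y0 \<in> E2" "(x0, y0) \<in> U"
    and hc: "has_continuous_partials_at f (x0, y0)"
    and sq: "s < \<bar>partial_y f (x0, y0) / partial_x f (x0, y0)\<bar>"
      "\<bar>partial_y f (x0, y0) / partial_x f (x0, y0)\<bar> < q"
    using assms(8) unfolding s_def q_def by blast
  define a where "a = \<bar>partial_x f (x0, y0)\<bar>"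
  define b where "b = \<bar>partial_y f (x0, y0)\<bar>"
  \<comment> \<open>A real supremum bounds its family only if the family is bounded above, here by
    1. The infimum in \<open>qle\<close> similarly relies on the lower bound 0.\<close>
  have sle: "1 - c k * real (n k) \<le> s" if "k \<ge> 1" for k
    unfolding s_def using that assms(2)
    by (intro cSUP_upper bdd_aboveI2[of _ _ 1]) (auto simp: less_imp_le)
  have qle: "q * (1 - c k * real (n k)) \<le> c k" if "k \<ge> 1" for k
  proof -
    have nn: "0 \<le> c k / (1 - real (n k) * c k)" if "k \<ge> 1" for k
      using assms(2,3)[OF that] by (simp add: mult.commute)
    have "q \<le> c k / (1 - real (n k) * c k)"
      unfolding q_def using that nn by (intro cINF_lower bdd_belowI2[of _ 0]) auto
    then show ?thesis
      using assms(3)[OF that] by (simp add: field_simps)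
  qed
  have "s > 0"
    using sle[of 1] assms(3)[of 1] by simp
  \<comment> \<open>If either partial vanished, the quotient would be 0 (for the denominator by the
    convention on division), contradicting \<open>s > 0\<close>.\<close>
  then have a: "a > 0" and b: "b > 0"
    using sq(1) by (auto simp: a_def b_def)
  have "q > 0"
    using sq(2) by (smt (verit) abs_ge_zero)
  have sa: "s * a < b" and bq: "b < q * a"
    using sq a by (auto simp: a_def b_def abs_divide field_simps)
  \<comment> \<open>The first two entries keep \<open>a - e\<close> and \<open>b - e\<close>
    positive; the last two are the largest \<open>e\<close> allowed by \<open>es\<close> and
    \<open>eq\<close>, respectively.\<close>
  define e where "e = Min {a / 2, b / 2, (b - s * a) / (1 + s), (q * a - b) / (1 + q)}"
  have "e > 0"
    using a b \<open>s > 0\<close> \<open>q > 0\<close> sa bq by (simp add: e_def)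
  moreover have "e \<le> d" if "d \<in> {a / 2, b / 2, (b - s * a) / (1 + s), (q * a - b) / (1 + q)}" for d
    unfolding e_def using that by (rule Min_le[rotated]) simp
  ultimately have e: "e > 0" "e \<le> a / 2" "e \<le> b / 2" "e \<le> (b - s * a) / (1 + s)" "e \<le> (q * a - b) / (1 + q)"
    by blast+
  have es: "(a + e) * s \<le> b - e" and eq: "b + e \<le> (a - e) * q"
    using e(4,5) \<open>s > 0\<close> \<open>q > 0\<close> by (auto simp: field_simps)
  obtain r where r: "r > 0" and box: "{x0 - r..x0 + r} \<times> {y0 - r..y0 + r} \<subseteq> U"
    and h1: "\<And>x x' y. x \<in> {x0 - r..x0 + r} \<Longrightarrow> x' \<in> {x0 - r..x0 + r} \<Longrightarrow> y \<in> {y0 - r..y0 + r} \<Longrightarrow>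
      (a - e) * \<bar>x - x'\<bar> \<le> \<bar>f (x, y) - f (x', y)\<bar> \<and> \<bar>f (x, y) - f (x', y)\<bar> \<le> (a + e) * \<bar>x - x'\<bar>"
    and h2: "\<And>x y y'. x \<in> {x0 - r..x0 + r} \<Longrightarrow> y \<in> {y0 - r..y0 + r} \<Longrightarrow> y' \<in> {y0 - r..y0 + r} \<Longrightarrow>
      (b - e) * \<bar>y - y'\<bar> \<le> \<bar>f (x, y) - f (x, y')\<bar> \<and> \<bar>f (x, y) - f (x, y')\<bar> \<le> (b + e) * \<bar>y - y'\<bar>"
    unfolding a_def b_def by (rule continuous_partials_box[OF hc assms(6) p(3) e(1)]) blast
  let ?X = "{x0 - r..x0 + r}" and ?Y = "{y0 - r..y0 + r}"
  obtain T1 where T1: "moran_structure c n T1" and E1: "E1 = (\<Inter>k\<in>{1..}. moran_level n T1 k)"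
    using assms(4) unfolding moran_sets_def moran_level_def by blast
  obtain T2 where T2: "moran_structure c n T2" and E2: "E2 = (\<Inter>k\<in>{1..}. moran_level n T2 k)"
    using assms(5) unfolding moran_sets_def moran_level_def by blast
  obtain k where k: "k \<ge> 1" "(\<Prod>j=1..k. c j) < r"
    by (rule moran_side_less[of n c r]) (use assms(1-3) r in blast)+
  have "x0 \<in> moran_level n T1 k" "y0 \<in> moran_level n T2 k"
    using p k(1) by (auto simp: E1 E2)
  then obtain \<sigma> \<tau> where \<sigma>: "\<sigma> \<in> words n k" "x0 \<in> T1 \<sigma>" and \<tau>: "\<tau> \<in> words n k" "y0 \<in> T2 \<tau>"
    unfolding moran_level_def by blast
  define L where "L = (\<Prod>j=1..k. c j)"
  have L: "L > 0"
    unfolding L_def using assms(2) by (intro prod_pos) auto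
  obtain l where l: "T1 \<sigma> = {l..l + L}"
    using moran_structure_Icc[OF T1 assms(2) \<sigma>(1)] unfolding L_def by blast
  obtain m where m: "T2 \<tau> = {m..m + L}"
    using moran_structure_Icc[OF T2 assms(2) \<tau>(1)] unfolding L_def by blast
  \<comment> \<open>Each interval contains its base coordinate and has length less than
    \<open>r\<close>.\<close>
  have sub: "T1 \<sigma> \<subseteq> ?X" "T2 \<tau> \<subseteq> ?Y"
    using \<sigma>(2) \<tau>(2) l m k(2) unfolding L_def[symmetric] by auto
  have "f ` (T1 \<sigma> \<times> T2 \<tau>) \<subseteq> f ` (T1 \<sigma> \<times> T2 \<tau> \<inter> E1 \<times> E2)"
    unfolding E1 E2
  proof (rule basic_square_image[OF T1 T2 assms(2) \<sigma>(1) \<tau>(1) sub _ _ _ _ _ h1 h2])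
    show "continuous_on (?X \<times> ?Y) f"
      using assms(7) box by (rule continuous_on_subset)
    show "(a + e) * (1 - c k * real (n k)) \<le> b - e" if "k \<ge> 1" for k
      using mult_left_mono[OF sle[OF that], of "a + e"] es a e(1) by linarith
    show "(b + e) * (1 - c k * real (n k)) \<le> (a - e) * c k" if "k \<ge> 1" for k
    proof -
      have "(b + e) * (1 - c k * real (n k)) \<le> (a - e) * q * (1 - c k * real (n k))"
        using eq assms(3)[OF that] by (intro mult_right_mono) auto
      also have "\<dots> \<le> (a - e) * c k"
        using mult_left_mono[OF qle[OF that], of "a - e"] e(2) a by (simp add: mult.assoc)
      finally show ?thesis .
    qed
  qed (use a b e in auto)
  also have "\<dots> \<subseteq> {f (x, y) | x y. (x, y) \<in> (E1 \<times> E2) \<inter> U}"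
    using sub box by blast
  finally have fsub: "f ` (T1 \<sigma> \<times> T2 \<tau>) \<subseteq> {f (x, y) | x y. (x, y) \<in> (E1 \<times> E2) \<inter> U}" .
  \<comment> \<open>One horizontal section already has an interval in its image: it is continuous,
    and the lower bound in \<open>h1\<close> separates its values at the two ends.\<close>
  define g where "g x = f (x, y0)" for x
  have "continuous_on (T1 \<sigma>) g"
    unfolding g_def using sub box \<tau>(2)
    by (intro continuous_on_compose2[OF assms(7)] continuous_intros) auto
  then have conn: "connected (g ` T1 \<sigma>)"
    by (rule connected_continuous_image) (simp add: l)
  have "0 < (a - e) * L"
    using e(2) a L by (intro mult_pos_pos) auto
  also have "\<dots> \<le> \<bar>g (l + L) - g l\<bar>"
    using h1[of "l + L" l y0] sub l L r by (auto simp: g_def)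
  finally have ne: "g (l + L) \<noteq> g l" by auto
  have mem: "g (l + L) \<in> g ` T1 \<sigma>" "g l \<in> g ` T1 \<sigma>"
    using l L by auto
  \<comment> \<open>The sign of the partial in x is unknown, so the end values may come in either
    order.\<close>
  define u v where "u = min (g l) (g (l + L))" and "v = max (g l) (g (l + L))"
  have "u < v" "u \<in> g ` T1 \<sigma>" "v \<in> g ` T1 \<sigma>"
    using ne mem by (auto simp: u_def v_def min_def max_def)
  then have "{u..v} \<subseteq> g ` T1 \<sigma>"
    using connected_contains_Icc[OF conn] by blast
  also have "\<dots> \<subseteq> f ` (T1 \<sigma> \<times> T2 \<tau>)"
    using \<tau>(2) by (auto simp: g_def)
  also note fsub
  finally have "interior {u..v} \<subseteq> interior {f (x, y) | x y. (x, y) \<in> (E1 \<times> E2) \<inter> U}"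
    by (rule interior_mono)
  with \<open>u < v\<close> show ?thesis
    by (metis dense_order_class.dense equals0D greaterThanLessThan_iff interior_atLeastAtMost_real subset_empty)
qed

end
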